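(* Let $n\geq 4$ be an even integer and let $(a,b,c)$ be a triple of nonnegative integers with $a+b+c=n-1$. For $0\le k\le n$ put $$ \lambda_k=\binom{n}{k}\Bigg[(-1)^c\binom{n-k}{c}\sum_{\ell=\max(0,\,k-b)}^{\min(a,\,k)}(-1)^{\ell}\binom{k}{\ell}\;-\;(-1)^a\binom{n-k}{a}\sum_{\ell=\max(0,\,k-b)}^{\min(c,\,k)}(-1)^{\ell}\binom{k}{\ell}\Bigg], $$ (a sum whose lower limit exceeds its upper limit being $0$), and define $\mu_k=\lambda_k+\lambda_{n-k}$ for $0\le k<\frac n2$ and $\mu_{n/2}=\lambda_{n/2}$. Explicitly, for $0\le k<\frac n2$, $$ \mu_k=\binom{n}{k}\Bigg[(-1)^c\binom{n-k}{c}\sum_{\ell=\max(0,k-b)}^{\min(a,k)}(-1)^{\ell}\binom{k}{\ell}+(-1)^c\binom{k}{c}\sum_{\ell=\max(0,n-k-b)}^{\min(a,n-k)}(-1)^{\ell}\binom{n-k}{\ell} $$ $$ -(-1)^a\binom{n-k}{a}\sum_{\ell=\max(0,k-b)}^{\min(c,k)}(-1)^{\ell}\binom{k}{\ell}-(-1)^a\binom{k}{a}\sum_{\ell=\max(0,n-k-b)}^{\min(c,n-k)}(-1)^{\ell}\binom{n-k}{\ell}\Bigg]. $$ Then $$ \sum_{k=0}^{n/2}\mu_k B_kB_{n-k}=0 . $$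
   Context: $B_k$ denotes the $k$-th Bernoulli number, defined by $\frac{t}{e^t-1}=\sum_{k\ge0}B_k\frac{t^k}{k!}$. Binomial coefficients $\binom{m}{r}$ with $0\le m<r$ are $0$. *)

theory Defs
  imports Complex_Main "HOL-Computational_Algebra.Formal_Power_Series"
begin

text \<open>
  Division of formal power series over a field cancels common powers of the indeterminate, so
  \<open>fps_X / (fps_exp 1 - 1)\<close> is the genuine power series of \<open>t / (e^t - 1)\<close>, although
  \<open>fps_exp 1 - 1\<close> is not invertible; see \<open>bernoulli_gen_fun\<close>.
\<close>

definition bernoulli :: "nat \<Rightarrow> real" where
  "bernoulli k = fact k * fps_nth (fps_X / (fps_exp 1 - 1)) k"

lemma bernoulli_gen_fun:
  "Abs_fps (\<lambda>k. bernoulli k / fact k) * (fps_exp 1 - 1) = fps_X"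
proof -
  let ?g = "fps_exp (1::real) - 1"
  have g1: "fps_nth ?g 1 \<noteq> 0" and g0: "fps_nth ?g 0 = 0" by simp_all
  then have sd: "subdegree ?g = 1"
    by (intro subdegreeI) auto
  have "?g \<noteq> 0" using g1 by force
  then have "?g dvd fps_X"
    using sd by (simp add: fps_dvd_iff)
  moreover have "Abs_fps (\<lambda>k. bernoulli k / fact k) = fps_X / ?g"
    by (rule fps_ext) (simp add: bernoulli_def)
  ultimately show ?thesis by simp
qed

text \<open>
  In the sums below the lower limit \<open>k - b\<close> is truncated subtraction on \<^typ>\<open>nat\<close>,
  that is, \<open>max (0, k - b)\<close>.
\<close>

definition lam :: "nat \<Rightarrow> nat \<Rightarrow> nat \<Rightarrow> nat \<Rightarrow> nat \<Rightarrow> int" where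
  "lam n a b c k = int (n choose k) *
     ((-1) ^ c * int ((n - k) choose c) * (\<Sum>l = k - b..min a k. (-1) ^ l * int (k choose l))
    - (-1) ^ a * int ((n - k) choose a) * (\<Sum>l = k - b..min c k. (-1) ^ l * int (k choose l)))"

text \<open>Only the values for \<open>2 * k \<le> n\<close> with \<open>n\<close> even are meaningful.\<close>

definition mu :: "nat \<Rightarrow> nat \<Rightarrow> nat \<Rightarrow> nat \<Rightarrow> nat \<Rightarrow> int" where
  "mu n a b c k =
     (if 2 * k < n then lam n a b c k + lam n a b c (n - k) else lam n a b c k)"

end

theory Submission
  imports Defs "HOL-Computational_Algebra.Polynomial"
begin

text \<open>
  Write \<open>B\<^sub>k\<close> for the Bernoulli numbers, \<open>\<beta>(t) = t / (e\<^sup>t - 1)\<close> and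
  \<open>w\<^sub>k = B\<^sub>k B\<^sub>n\<^sub>-\<^sub>k / (k! (n-k)!)\<close>. Since the two halves of \<open>\<mu>\<close> fold the range \<open>0..n\<close>, the
  sum in question is \<open>\<Sum>k\<le>n. \<lambda>\<^sub>k B\<^sub>k B\<^sub>n\<^sub>-\<^sub>k\<close>. The first half of \<open>\<lambda>\<^sub>k\<close>, weighted in this way and summed
  over \<open>k\<close>, is \<open>n!\<close> times the coefficient of \<open>x\<^sup>a z\<^sup>c\<close> in the polynomial
  \<open>F(x,z) = \<Sum>k\<le>n. w\<^sub>k (1-x)\<^sup>k ((x-z)\<^sup>n\<^sup>-\<^sup>k - (1-z)\<^sup>n\<^sup>-\<^sup>k) / (x-1)\<close>, and the second half is the coefficient
  of \<open>x\<^sup>c z\<^sup>a\<close>. So the claim is the symmetry of \<open>F\<close>. With \<open>u = 1-x\<close> and \<open>v = 1-z\<close> it is the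
  degree \<open>n\<close> part of
  \<open>v \<beta>(ut) (\<beta>((v-u)t) - \<beta>(vt)) = u \<beta>(vt) (\<beta>((u-v)t) - \<beta>(ut))\<close>, a rational identity
  in \<open>e\<^sup>u\<^sup>t\<close> and \<open>e\<^sup>v\<^sup>t\<close>.
\<close>

section \<open>The generating function identity\<close>

definition bernoulli_fps :: "real \<Rightarrow> real fps" where
  "bernoulli_fps u = Abs_fps (\<lambda>k. bernoulli k / fact k * u ^ k)"

text \<open>\<open>bernoulli_fps u\<close> is \<beta>(ut). Replacing t by ut in
  \<open>bernoulli_gen_fun\<close> scales the coefficient of t^m by u^m.\<close>

lemma bernoulli_fps_mult_exp:
  "bernoulli_fps u * (fps_exp u - 1) = fps_const u * fps_X"
proof (rule fps_ext)
  fix m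
  have "fps_nth (bernoulli_fps u * (fps_exp u - 1)) m
      = u ^ m * fps_nth (Abs_fps (\<lambda>k. bernoulli k / fact k) * (fps_exp 1 - 1)) m"
    unfolding fps_mult_nth sum_distrib_left
  proof (rule sum.cong)
    fix i assume "i \<in> {0..m}"
    then have "u ^ m = u ^ i * u ^ (m - i)"
      by (simp flip: power_add)
    then show "fps_nth (bernoulli_fps u) i * fps_nth (fps_exp u - 1) (m - i) = u ^ m *
      (fps_nth (Abs_fps (\<lambda>k. bernoulli k / fact k)) i * fps_nth (fps_exp 1 - 1) (m - i))"
      by (cases "m = i") (simp_all add: bernoulli_fps_def)
  qed simp
  then show "fps_nth (bernoulli_fps u * (fps_exp u - 1)) m = fps_nth (fps_const u * fps_X) m"
    by (cases "m = 1") (simp_all add: bernoulli_gen_fun)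
qed

text \<open>Clears the denominator of \<beta>((v-u)t) using only the exponentials of ut and vt, so
  that the next identity becomes polynomial in these two.\<close>

lemma bernoulli_fps_diff_mult_exp:
  "bernoulli_fps (v - u) * (fps_exp v - fps_exp u) = fps_const (v - u) * fps_X * fps_exp u"
proof -
  have "fps_exp v - fps_exp u = (fps_exp (v - u) - 1) * fps_exp u"
    by (simp add: algebra_simps flip: fps_exp_add_mult)
  then show ?thesis
    using bernoulli_fps_mult_exp[of "v - u"] by (simp add: mult.assoc[symmetric])
qed

lemma fps_exp_eq_iff: "fps_exp u = fps_exp v \<longleftrightarrow> u = v" for u v :: real
proof
  assume "fps_exp u = fps_exp v"
  then have "fps_nth (fps_exp u) 1 = fps_nth (fps_exp v) 1" by simp
  then show "u = v" by simp
qed simp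

lemma bernoulli_fps_identity:
  assumes "u \<noteq> 0" "v \<noteq> 0" "u \<noteq> v"
  shows "fps_const v * bernoulli_fps u * (bernoulli_fps (v - u) - bernoulli_fps v)
       = fps_const u * bernoulli_fps v * (bernoulli_fps (u - v) - bernoulli_fps u)"
proof -
  define p q where "p = fps_exp u" and "q = fps_exp v"
  define d where "d = (p - 1) * (q - 1) * (q - p)"
  \<comment> \<open>The hypotheses make the exponentials for 0, \<open>u\<close> and
    \<open>v\<close> pairwise distinct, so the common denominator \<open>d\<close> can be
    cancelled.\<close>
  have "d \<noteq> 0"
    unfolding d_def p_def q_def
    using assms fps_exp_eq_iff[of u 0] fps_exp_eq_iff[of v 0] fps_exp_eq_iff[of v u] by auto
  have *: "d * (V * A * (C - B)) = d * (U * B * (D - A))"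
    if "A * (p - 1) = U * fps_X" "B * (q - 1) = V * fps_X"
       "C * (q - p) = (V - U) * fps_X * p" "D * (p - q) = (U - V) * fps_X * q"
    for A B C D U V :: "real fps"
  proof -
    have "d * (V * A * (C - B)) = V * (A * (p - 1)) * ((q - 1) * (C * (q - p)) - (q - p) * (B * (q - 1)))"
      unfolding d_def by (simp add: algebra_simps)
    also have "\<dots> = V * U * fps_X * fps_X * ((q - 1) * (V - U) * p - (q - p) * V)"
      unfolding that by (simp add: algebra_simps)
    \<comment> \<open>Both brackets expand to (V - U) p q + U p - V q.\<close>
    also have "\<dots> = U * V * fps_X * fps_X * ((p - 1) * (V - U) * q - (q - p) * U)"
      by (simp add: algebra_simps)
    also have "\<dots> = U * (B * (q - 1)) * (- ((p - 1) * (D * (p - q))) - (q - p) * (A * (p - 1)))"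
      unfolding that by (simp add: algebra_simps)
    also have "\<dots> = d * (U * B * (D - A))"
      unfolding d_def by (simp add: algebra_simps)
    finally show ?thesis .
  qed
  have "d * (fps_const v * bernoulli_fps u * (bernoulli_fps (v - u) - bernoulli_fps v))
      = d * (fps_const u * bernoulli_fps v * (bernoulli_fps (u - v) - bernoulli_fps u))"
    using bernoulli_fps_mult_exp[of u] bernoulli_fps_mult_exp[of v]
      bernoulli_fps_diff_mult_exp[of v u] bernoulli_fps_diff_mult_exp[of u v]
    by (intro *) (simp_all add: p_def q_def)
  with \<open>d \<noteq> 0\<close> show ?thesis by simp
qed

definition bernoulli_weight :: "nat \<Rightarrow> nat \<Rightarrow> real" where
  "bernoulli_weight n k = bernoulli k / fact k * (bernoulli (n - k) / fact (n - k))"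

text \<open>Compares the coefficients of t^n in \<open>bernoulli_fps_identity\<close>.\<close>

lemma bernoulli_weight_identity:
  assumes "u \<noteq> 0" "v \<noteq> 0" "u \<noteq> v"
  shows "v * (\<Sum>k\<le>n. bernoulli_weight n k * u ^ k * ((v - u) ^ (n - k) - v ^ (n - k)))
       = u * (\<Sum>k\<le>n. bernoulli_weight n k * v ^ k * ((u - v) ^ (n - k) - u ^ (n - k)))"
proof -
  have "fps_nth (fps_const s * bernoulli_fps r * (bernoulli_fps t - bernoulli_fps s)) n
      = s * (\<Sum>k\<le>n. bernoulli_weight n k * r ^ k * (t ^ (n - k) - s ^ (n - k)))" for r s t
  proof -
    have "fps_nth (bernoulli_fps r * (bernoulli_fps t - bernoulli_fps s)) n
        = (\<Sum>k\<le>n. bernoulli_weight n k * r ^ k * (t ^ (n - k) - s ^ (n - k)))"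
      unfolding fps_mult_nth atLeast0AtMost
      by (intro sum.cong refl)
        (simp add: bernoulli_fps_def bernoulli_weight_def algebra_simps diff_divide_distrib)
    then show ?thesis
      by (simp only: mult.assoc fps_mult_left_const_nth)
  qed
  from this[of v u "v - u"] this[of u v "u - v"] show ?thesis
    using bernoulli_fps_identity[OF assms] by simp
qed

section \<open>Coefficients of F and their symmetry\<close>

definition geom_coeff :: "nat \<Rightarrow> nat \<Rightarrow> nat \<Rightarrow> real" where
  "geom_coeff m k i = (\<Sum>l\<le>i. (-1) ^ l * real (k choose l) * of_bool (i - l < m))"

text \<open>\<open>geom_coeff m k i\<close> is the coefficient of x^i in (1-x)^k (1 + x + ... +
  x^(m-1)), a polynomial of degree at most n. Multiplying by x - 1 telescopes the geometric
  factor.\<close>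

lemma geom_coeff_sum:
  assumes "k + m \<le> n"
  shows "(x - 1) * (\<Sum>i\<le>n. geom_coeff m k i * x ^ i) = (1 - x) ^ k * (x ^ m - 1)"
proof -
  define p where "p = [:1, -1:] ^ k * (\<Sum>j<m. monom (1::real) j)"
  have "coeff ([:1, -1:] ^ k) l = (-1) ^ l * real (k choose l)" for l
  proof (cases "l \<le> k")
    case False
    have "degree ([:1, -1::real:] ^ k) \<le> k"
      using degree_power_le[of "[:1, -1::real:]" k] by simp
    with False show ?thesis by (simp add: coeff_eq_0)
  qed (simp add: coeff_linear_poly_power)
  then have coeff: "coeff p i = geom_coeff m k i" for i
    by (simp add: p_def coeff_mult geom_coeff_def coeff_sum of_bool_def)
  have "coeff p i = 0" if "i > n" for i
  proof -
    have "(k choose l) = 0 \<or> \<not> i - l < m" if "l \<le> i" for l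
      using \<open>i > n\<close> assms that by (cases "l \<le> k") (auto simp: binomial_eq_0)
    then show ?thesis
      unfolding coeff geom_coeff_def by (intro sum.neutral) auto
  qed
  then have "degree p \<le> n"
    by (intro degree_le) auto
  then have "(\<Sum>i\<le>n. geom_coeff m k i * x ^ i) = poly p x"
    unfolding poly_altdef coeff[symmetric]
    by (intro sum.mono_neutral_right) (auto simp: coeff_eq_0)
  also have "\<dots> = (1 - x) ^ k * (\<Sum>j<m. x ^ j)"
    by (simp add: p_def poly_sum poly_monom)
  finally show ?thesis
    by (simp add: power_diff_1_eq)
qed

text \<open>The coefficient of x^i z^j in F(x,z): the z^j part of (x-z)^(n-k) - (1-z)^(n-k) is
  (-1)^j binom(n-k,j) (x^(n-k-j) - 1), and \<open>geom_coeff\<close> absorbs the factor (1-x)^k /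
  (x-1).\<close>

definition sym_coeff :: "nat \<Rightarrow> nat \<Rightarrow> nat \<Rightarrow> real" where
  "sym_coeff n i j = (\<Sum>k\<le>n. bernoulli_weight n k * ((-1) ^ j * real ((n - k) choose j))
     * geom_coeff (n - k - j) k i)"

lemma sym_coeff_sum:
  "(x - 1) * (\<Sum>i\<le>n. \<Sum>j\<le>n. sym_coeff n i j * x ^ i * z ^ j)
   = (\<Sum>k\<le>n. bernoulli_weight n k * (1 - x) ^ k * ((x - z) ^ (n - k) - (1 - z) ^ (n - k)))"
proof -
  let ?w = "bernoulli_weight n"
  have "(\<Sum>i\<le>n. \<Sum>j\<le>n. sym_coeff n i j * x ^ i * z ^ j)
      = (\<Sum>i\<le>n. \<Sum>j\<le>n. \<Sum>k\<le>n. ?w k * (real ((n - k) choose j) * (-z) ^ j) *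
          (geom_coeff (n - k - j) k i * x ^ i))"
    unfolding sym_coeff_def sum_distrib_right
    by (intro sum.cong refl) (simp add: power_minus[of z])
  also have "\<dots> = (\<Sum>j\<le>n. \<Sum>i\<le>n. \<Sum>k\<le>n. ?w k * (real ((n - k) choose j) * (-z) ^ j) *
          (geom_coeff (n - k - j) k i * x ^ i))"
    by (rule sum.swap)
  also have "\<dots> = (\<Sum>j\<le>n. \<Sum>k\<le>n. \<Sum>i\<le>n. ?w k * (real ((n - k) choose j) * (-z) ^ j) *
          (geom_coeff (n - k - j) k i * x ^ i))"
    by (intro sum.cong refl sum.swap)
  also have "\<dots> = (\<Sum>k\<le>n. \<Sum>j\<le>n. \<Sum>i\<le>n. ?w k * (real ((n - k) choose j) * (-z) ^ j) *
          (geom_coeff (n - k - j) k i * x ^ i))"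
    by (rule sum.swap)
  finally have "(x - 1) * (\<Sum>i\<le>n. \<Sum>j\<le>n. sym_coeff n i j * x ^ i * z ^ j)
      = (\<Sum>k\<le>n. ?w k * (\<Sum>j\<le>n. real ((n - k) choose j) * (-z) ^ j *
          ((x - 1) * (\<Sum>i\<le>n. geom_coeff (n - k - j) k i * x ^ i))))"
    by (simp add: sum_distrib_left mult_ac)
  also have "\<dots> = (\<Sum>k\<le>n. ?w k * (1 - x) ^ k * ((x - z) ^ (n - k) - (1 - z) ^ (n - k)))"
  proof (intro sum.cong refl)
    fix k assume "k \<in> {..n}"
    then have "(\<Sum>j\<le>n. real ((n - k) choose j) * (-z) ^ j *
          ((x - 1) * (\<Sum>i\<le>n. geom_coeff (n - k - j) k i * x ^ i)))
        = (\<Sum>j\<le>n. real ((n - k) choose j) * (-z) ^ j * ((1 - x) ^ k * (x ^ (n - k - j) - 1)))"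
      \<comment> \<open>For j > n - k the truncated exponent n - k - j is 0, so the bound k + (n - k
        - j) \<le> n holds for every j.\<close>
      by (intro sum.cong refl, subst geom_coeff_sum) auto
    also have "\<dots> = (\<Sum>j\<le>n - k. real ((n - k) choose j) * (-z) ^ j * ((1 - x) ^ k * (x ^ (n - k - j) - 1)))"
      by (intro sum.mono_neutral_right) (auto simp: binomial_eq_0)
    also have "\<dots> = (1 - x) ^ k * ((-z + x) ^ (n - k) - (-z + 1) ^ (n - k))"
      unfolding binomial_ring right_diff_distrib sum_subtractf[symmetric] sum_distrib_left
      by (simp add: mult_ac)
    finally show "?w k * (\<Sum>j\<le>n. real ((n - k) choose j) * (-z) ^ j *
          ((x - 1) * (\<Sum>i\<le>n. geom_coeff (n - k - j) k i * x ^ i)))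
        = ?w k * (1 - x) ^ k * ((x - z) ^ (n - k) - (1 - z) ^ (n - k))"
      by simp
  qed
  finally show ?thesis .
qed

text \<open>Allows coefficients to be compared although F(x,z) = F(z,x) is first obtained only away
  from x = 1, z = 1 and x = z.\<close>

lemma polyfun_cofinite_zero:
  fixes f :: "nat \<Rightarrow> real"
  assumes "finite S" and "\<And>x. x \<notin> S \<Longrightarrow> (\<Sum>i\<le>n. f i * x ^ i) = 0" and "i \<le> n"
  shows "f i = 0"
proof -
  have "infinite (- S)"
    using assms(1) by (simp add: Compl_eq_Diff_UNIV infinite_UNIV_char_0)
  then have "infinite {x. (\<Sum>i\<le>n. f i * x ^ i) = 0}"
    by (rule infinite_super[rotated]) (use assms(2) in auto)
  then show ?thesis
    using polyfun_finite_roots[where c = f and n = n] assms(3) by blast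
qed

lemma sym_coeff_commute:
  assumes "i \<le> n" "j \<le> n"
  shows "sym_coeff n i j = sym_coeff n j i"
proof -
  define d where "d i j = sym_coeff n i j - sym_coeff n j i" for i j
  have d_sum: "(\<Sum>i\<le>n. (\<Sum>j\<le>n. d i j * z ^ j) * x ^ i) = 0"
    if "x \<noteq> 1" "z \<noteq> 1" "x \<noteq> z" for x z
  proof -
    define F where "F x z = (\<Sum>i\<le>n. \<Sum>j\<le>n. sym_coeff n i j * x ^ i * z ^ j)" for x z
    \<comment> \<open>With u = 1 - x and v = 1 - z one has v - u = x - z, so this is
      \<open>bernoulli_weight_identity\<close>.\<close>
    have "(1 - z) * ((x - 1) * F x z) = (1 - x) * ((z - 1) * F z x)"
      unfolding F_def sym_coeff_sum
      using bernoulli_weight_identity[of "1 - x" "1 - z" n] that by simp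
    then have "(1 - z) * (x - 1) * (F x z - F z x) = 0"
      by (simp add: algebra_simps)
    with that have "F x z = F z x" by simp
    moreover have "F z x = (\<Sum>i\<le>n. \<Sum>j\<le>n. sym_coeff n j i * x ^ i * z ^ j)"
      unfolding F_def by (subst sum.swap) (simp add: mult_ac)
    moreover have "(\<Sum>i\<le>n. (\<Sum>j\<le>n. d i j * z ^ j) * x ^ i) =
        F x z - (\<Sum>i\<le>n. \<Sum>j\<le>n. sym_coeff n j i * x ^ i * z ^ j)"
      unfolding F_def d_def sum_distrib_right sum_subtractf[symmetric]
      by (intro sum.cong refl) (simp add: algebra_simps)
    ultimately show ?thesis by simp
  qed
  \<comment> \<open>Coefficients are compared in x for fixed z, then in z.\<close>
  have "(\<Sum>j\<le>n. d i j * z ^ j) = 0" if "z \<notin> {1}" for z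
    by (rule polyfun_cofinite_zero[of "{1, z}"]) (use d_sum that assms in auto)
  then have "d i j = 0"
    using polyfun_cofinite_zero[where S = "{1}" and n = n and f = "d i" and i = j] assms by blast
  then show ?thesis by (simp add: d_def)
qed

section \<open>Return to the numbers \<lambda> and \<mu>\<close>

lemma sym_coeff_eq:
  assumes "a + b + c + 1 = n"
  shows "fact n * sym_coeff n a c = (\<Sum>k\<le>n. real (n choose k) * ((-1) ^ c * real ((n - k) choose c) *
     (\<Sum>l = k - b..min a k. (-1) ^ l * real (k choose l))) * bernoulli k * bernoulli (n - k))"
  unfolding sym_coeff_def
proof (subst sum_distrib_left, intro sum.cong refl)
  fix k assume "k \<in> {..n}"
  then have k: "k \<le> n" by simp
  have geom: "real ((n - k) choose c) * geom_coeff (n - k - c) k a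
      = real ((n - k) choose c) * (\<Sum>l = k - b..min a k. (-1) ^ l * real (k choose l))"
  proof (cases "c \<le> n - k")
    case True
    \<comment> \<open>Since a + c = n - 1 - b, for l \<le> a the condition a - l < n - k - c says
      exactly k - b \<le> l. Terms with l > k have zero binomial coefficient.\<close>
    have "(\<Sum>l = k - b..min a k. (-1) ^ l * real (k choose l)) = geom_coeff (n - k - c) k a"
      unfolding geom_coeff_def
      using True k assms
      by (intro sum.mono_neutral_cong_left) (auto simp: binomial_eq_0)
    then show ?thesis by simp
  qed (simp add: binomial_eq_0)
  have weight: "fact n * bernoulli_weight n k = real (n choose k) * bernoulli k * bernoulli (n - k)"
    using k by (simp add: bernoulli_weight_def binomial_fact)
  have "fact n * (bernoulli_weight n k * ((-1) ^ c * real ((n - k) choose c)) *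
      geom_coeff (n - k - c) k a) = (fact n * bernoulli_weight n k) * (-1) ^ c *
        (real ((n - k) choose c) * geom_coeff (n - k - c) k a)"
    by (simp only: mult_ac)
  then show "fact n * (bernoulli_weight n k * ((-1) ^ c * real ((n - k) choose c)) *
      geom_coeff (n - k - c) k a) = real (n choose k) * ((-1) ^ c * real ((n - k) choose c) *
     (\<Sum>l = k - b..min a k. (-1) ^ l * real (k choose l))) * bernoulli k * bernoulli (n - k)"
    unfolding geom weight by (simp only: mult_ac)
qed

text \<open>The two halves of \<open>lam\<close> differ by exchanging a and c, which preserves a + b
  + c + 1 = n. The symmetry of \<open>sym_coeff\<close> therefore cancels them after
  summation.\<close>

lemma lam_bernoulli_sum:
  assumes "a + b + c + 1 = n"
  shows "(\<Sum>k\<le>n. of_int (lam n a b c k) * bernoulli k * bernoulli (n - k)) = 0"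
proof -
  have "(\<Sum>k\<le>n. of_int (lam n a b c k) * bernoulli k * bernoulli (n - k))
      = fact n * sym_coeff n a c - fact n * sym_coeff n c a"
    using sym_coeff_eq[of a b c n] sym_coeff_eq[of c b a n] assms
    by (simp add: lam_def algebra_simps sum_subtractf)
  also have "\<dots> = 0"
    using sym_coeff_commute[of a n c] assms by simp
  finally show ?thesis .
qed

text \<open>The reflection k -> n - k carries the indices below n/2 onto those above; the middle
  index is its own partner and is counted once.\<close>

lemma sum_fold_even:
  fixes f :: "nat \<Rightarrow> 'a :: comm_monoid_add"
  assumes "even n"
  shows "(\<Sum>k = 0..n div 2. if 2 * k < n then f k + f (n - k) else f k) = (\<Sum>k\<le>n. f k)"
proof -
  obtain m where n: "n = 2 * m" using assms by blast
  have "(\<Sum>k = 0..n div 2. if 2 * k < n then f k + f (n - k) else f k)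
      = (\<Sum>k<m. f k + f (n - k)) + f m"
    by (simp add: n atLeast0AtMost lessThan_Suc_atMost[symmetric])
  also have "(\<Sum>k<m. f (n - k)) = (\<Sum>k\<in>{m<..n}. f k)"
    by (rule sum.reindex_bij_witness[of _ "\<lambda>k. n - k" "\<lambda>k. n - k"]) (auto simp: n)
  then have "(\<Sum>k<m. f k + f (n - k)) + f m = (\<Sum>k\<in>{..m} \<union> {m<..n}. f k)"
    by (subst sum.union_disjoint) (auto simp: sum.distrib add_ac lessThan_Suc_atMost[symmetric])
  also have "{..m} \<union> {m<..n} = {..n}" by (auto simp: n)
  finally show ?thesis .
qed

theorem theorem4:
  fixes n a b c :: nat
  assumes "n \<ge> 4" and "even n" and "a + b + c = n - 1"
  shows "(\<forall>k. 2 * k < n \<longrightarrow>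
           mu n a b c k = int (n choose k) *
             ((-1) ^ c * int ((n - k) choose c) *
                (\<Sum>l = k - b..min a k. (-1) ^ l * int (k choose l))
            + (-1) ^ c * int (k choose c) *
                (\<Sum>l = n - k - b..min a (n - k). (-1) ^ l * int ((n - k) choose l))
            - (-1) ^ a * int ((n - k) choose a) *
                (\<Sum>l = k - b..min c k. (-1) ^ l * int (k choose l))
            - (-1) ^ a * int (k choose a) *
                (\<Sum>l = n - k - b..min c (n - k). (-1) ^ l * int ((n - k) choose l))))
       \<and> (\<Sum>k = 0..n div 2. of_int (mu n a b c k) * bernoulli k * bernoulli (n - k)) = 0"
proof (intro conjI allI impI)
  fix k assume "2 * k < n"
  moreover from this have "n choose (n - k) = n choose k" "n - (n - k) = k"
    by (simp_all add: binomial_symmetric[symmetric])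
  ultimately show "mu n a b c k = int (n choose k) *
             ((-1) ^ c * int ((n - k) choose c) *
                (\<Sum>l = k - b..min a k. (-1) ^ l * int (k choose l))
            + (-1) ^ c * int (k choose c) *
                (\<Sum>l = n - k - b..min a (n - k). (-1) ^ l * int ((n - k) choose l))
            - (-1) ^ a * int ((n - k) choose a) *
                (\<Sum>l = k - b..min c k. (-1) ^ l * int (k choose l))
            - (-1) ^ a * int (k choose a) *
                (\<Sum>l = n - k - b..min c (n - k). (-1) ^ l * int ((n - k) choose l)))"
    unfolding mu_def lam_def by (simp only: if_True algebra_simps)
next
  let ?f = "\<lambda>k. of_int (lam n a b c k) * bernoulli k * bernoulli (n - k)"
  have "(\<Sum>k = 0..n div 2. of_int (mu n a b c k) * bernoulli k * bernoulli (n - k))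
      = (\<Sum>k = 0..n div 2. if 2 * k < n then ?f k + ?f (n - k) else ?f k)"
    \<comment> \<open>The product of Bernoulli numbers is invariant under k -> n - k, so both halves
      of \<open>mu\<close> carry the same weight.\<close>
    by (intro sum.cong refl) (auto simp: mu_def algebra_simps)
  also have "\<dots> = (\<Sum>k\<le>n. ?f k)"
    by (rule sum_fold_even) fact
  also have "\<dots> = 0"
    by (rule lam_bernoulli_sum) (use assms in simp)
  finally show "(\<Sum>k = 0..n div 2. of_int (mu n a b c k) * bernoulli k * bernoulli (n - k)) = 0" .
qed

end
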